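(* For all non-negative integers $m$ and $n$, the box polynomial $B_{m,n}(x)$ satisfies $$B_{m,n}(x) = \frac{1}{n!}\,\Delta^{n}(x^{m+n}).$$
   Context: For non-negative integers $m,n$, the box polynomial is $$B_{m,n}(x)=\sum_{\lambda\subseteq m\times n}\ \prod_{i=1}^{m}(x+\lambda_i),$$ where the sum is over all integer sequences (partitions) $\lambda=(n\ge\lambda_1\ge\lambda_2\ge\cdots\ge\lambda_m\ge 0)$, i.e. partitions with $m$ non-negative parts, each at most $n$ (an empty product is $1$). The forward difference operator $\Delta$ on polynomials is $\Delta(p(x))=p(x+1)-p(x)$, and $\Delta^n$ is its $n$-fold iterate. *)

theory Defs
  imports Complex_Main "HOL-Computational_Algebra.Polynomial"
begin

text \<open>A partition in the \<open>m \<times> n\<close> box is a weakly decreasing list of exactly \<open>m\<close> parts, where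
  parts equal to zero are allowed. The part $\lambda_i$ is the list entry at position \<open>i - 1\<close>.\<close>

definition box_partitions :: "nat \<Rightarrow> nat \<Rightarrow> nat list set" where
  "box_partitions m n =
     {ls. length ls = m \<and> sorted_wrt (\<ge>) ls \<and> (\<forall>l \<in> set ls. l \<le> n)}"

lemma finite_box_partitions: "finite (box_partitions m n)"
proof (rule finite_subset)
  show "box_partitions m n \<subseteq> {xs. set xs \<subseteq> {..n} \<and> length xs = m}"
    by (auto simp: box_partitions_def)
  show "finite {xs. set xs \<subseteq> {..n} \<and> length xs = m}"
    by (rule finite_lists_length_eq) simp
qed

definition box_poly :: "nat \<Rightarrow> nat \<Rightarrow> 'a::comm_ring_1 poly" where
  "box_poly m n = (\<Sum>ls \<in> box_partitions m n. \<Prod>i<m. [:of_nat (ls ! i), 1:])"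

definition fwd_diff :: "'a::comm_ring_1 poly \<Rightarrow> 'a poly" where
  "fwd_diff p = pcompose p [:1, 1:] - p"

lemma poly_fwd_diff: "poly (fwd_diff p) x = poly p (x + 1) - poly p x"
  by (simp add: fwd_diff_def poly_pcompose add.commute)

end

theory Submission imports Defs begin

text \<open>Both sides satisfy the recurrence $F_{m+1,n+1} = (x+n+1) F_{m,n+1} + F_{m+1,n}$ with the same
  boundary values. For the box polynomial, split the partitions according to whether the largest part
  equals $n+1$; for the differences, apply the Leibniz rule for $\Delta^{n+1}$ to
  $x \cdot x^{m+n+1}$.\<close>

lemma box_partitions_0 [simp]: "box_partitions 0 n = {[]}"
  by (auto simp: box_partitions_def)

lemma box_partitions_zero_right [simp]: "box_partitions m 0 = {replicate m 0}"
proof -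
  have "ls = replicate m 0" if "ls \<in> box_partitions m 0" for ls
    using that by (auto simp: box_partitions_def replicate_length_same[symmetric])
  moreover have "replicate m 0 \<in> box_partitions m 0"
    by (auto simp: box_partitions_def sorted_wrt_iff_nth_less)
  ultimately show ?thesis by blast
qed

text \<open>The head of a weakly decreasing list is its maximum. If it differs from
  \<open>Suc n\<close>, it is at most \<open>n\<close>, and hence so is every other part.\<close>

lemma box_partitions_Suc_Suc:
  "box_partitions (Suc m) (Suc n) =
     Cons (Suc n) ` box_partitions m (Suc n) \<union> box_partitions (Suc m) n"
proof (intro equalityI subsetI)
  fix ls assume ls: "ls \<in> box_partitions (Suc m) (Suc n)"
  then obtain l ls' where "ls = l # ls'"
    by (cases ls) (auto simp: box_partitions_def)
  with ls show "ls \<in> Cons (Suc n) ` box_partitions m (Suc n) \<union> box_partitions (Suc m) n"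
    by (cases "l = Suc n") (force simp: box_partitions_def)+
next
  fix ls assume "ls \<in> Cons (Suc n) ` box_partitions m (Suc n) \<union> box_partitions (Suc m) n"
  then show "ls \<in> box_partitions (Suc m) (Suc n)"
    by (auto simp: box_partitions_def)
qed

lemma box_poly_0 [simp]: "box_poly 0 n = 1"
  by (simp add: box_poly_def)

lemma box_poly_zero_right: "box_poly m 0 = monom 1 m"
  by (simp add: box_poly_def monom_altdef)

lemma box_poly_Suc_Suc:
  "box_poly (Suc m) (Suc n) =
     [:of_nat (Suc n), 1:] * box_poly m (Suc n) + (box_poly (Suc m) n :: 'a::comm_ring_1 poly)"
proof -
  let ?f = "\<lambda>k ls. \<Prod>i<k. [:of_nat (ls ! i), 1 :: 'a:]"
  have disj: "Cons (Suc n) ` box_partitions m (Suc n) \<inter> box_partitions (Suc m) n = {}"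
    by (auto simp: box_partitions_def)
  \<comment> \<open>The new head supplies the factor at index 0, and the remaining indices shift
    down by one.\<close>
  have "(\<Sum>ls\<in>Cons (Suc n) ` box_partitions m (Suc n). ?f (Suc m) ls) =
      (\<Sum>ls\<in>box_partitions m (Suc n). [:of_nat (Suc n), 1:] * ?f m ls)"
    by (subst sum.reindex)
      (simp_all add: prod.lessThan_Suc_shift del: prod.lessThan_Suc mult_pCons_left of_nat_Suc)
  then show ?thesis
    unfolding box_poly_def box_partitions_Suc_Suc
    by (subst sum.union_disjoint[OF _ _ disj])
      (simp_all add: finite_box_partitions sum_distrib_left del: mult_pCons_left of_nat_Suc)
qed

lemma fwd_diff_add: "fwd_diff (p + q) = fwd_diff p + fwd_diff q"
  by (simp add: fwd_diff_def pcompose_add)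

lemma fwd_diff_smult: "fwd_diff (smult c p) = smult c (fwd_diff p)"
  by (simp add: fwd_diff_def pcompose_smult smult_diff_right)

lemma fwd_diff_const [simp]: "fwd_diff [:c:] = 0"
  by (simp add: fwd_diff_def)

lemma fwd_diff_linear_mult: "fwd_diff ([:c, 1:] * p) = [:c + 1, 1:] * fwd_diff p + p"
proof -
  have "pcompose [:c, 1:] [:1, 1:] = [:c + 1, 1:]"
    by (simp add: pcompose_pCons)
  moreover have "[:c + 1, 1:] = [:c, 1:] + 1"
    by (simp add: one_pCons)
  ultimately show ?thesis
    by (simp add: fwd_diff_def pcompose_mult algebra_simps del: mult_pCons_left mult_pCons_right)
qed

text \<open>Each further difference shifts the linear factor by one and releases one more copy of
  the lower difference of \<open>p\<close>. Writing the order as \<open>Suc n\<close> avoids a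
  truncated \<open>n - 1\<close>.\<close>

lemma fwd_diff_funpow_Suc_mult_x:
  "(fwd_diff ^^ Suc n) ([:0, 1:] * p) =
     [:of_nat (Suc n), 1:] * (fwd_diff ^^ Suc n) p + smult (of_nat (Suc n)) ((fwd_diff ^^ n) p)"
proof (induction n)
  case 0
  show ?case
    using fwd_diff_linear_mult[of 0 p] by simp
next
  case (Suc n)
  let ?q = "(fwd_diff ^^ Suc n) p"
  have "(fwd_diff ^^ Suc (Suc n)) ([:0, 1:] * p) =
      fwd_diff ((fwd_diff ^^ Suc n) ([:0, 1:] * p))"
    by simp
  \<comment> \<open>The single \<open>?q\<close> comes from differencing the linear factor; it
    raises the coefficient from \<open>Suc n\<close> to \<open>Suc (Suc n)\<close>.\<close>
  also have "\<dots> = [:of_nat (Suc n) + 1, 1:] * fwd_diff ?q + ?q + smult (of_nat (Suc n)) ?q"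
    unfolding Suc.IH fwd_diff_add fwd_diff_smult fwd_diff_linear_mult by simp
  also have "\<dots> = [:of_nat (Suc (Suc n)), 1:] * fwd_diff ?q + smult (of_nat (Suc (Suc n))) ?q"
    unfolding of_nat_Suc[of "Suc n"] smult_add_left smult_1_left by (simp only: add_ac)
  finally show ?case by simp
qed

lemma fwd_diff_funpow_Suc_monom_Suc:
  "(fwd_diff ^^ Suc n) (monom 1 (Suc k)) =
     [:of_nat (Suc n), 1:] * (fwd_diff ^^ Suc n) (monom 1 k)
       + smult (of_nat (Suc n)) ((fwd_diff ^^ n) (monom 1 k))"
  using fwd_diff_funpow_Suc_mult_x[of n "monom 1 k"] by (simp add: monom_Suc)

lemma fwd_diff_funpow_monom_self: "(fwd_diff ^^ n) (monom 1 n) = [:fact n:]"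
proof (induction n)
  case 0
  show ?case by (simp add: monom_0)
next
  case (Suc n)
  have "(fwd_diff ^^ Suc n) (monom (1::'a) n) = 0"
    by (simp add: Suc.IH)
  then show ?case
    unfolding fwd_diff_funpow_Suc_monom_Suc Suc.IH by simp
qed

theorem theorem2p6:
  fixes m n :: nat
  shows "(box_poly m n :: 'a::field_char_0 poly) =
           smult (1 / fact n) ((fwd_diff ^^ n) (monom 1 (m + n)))"
proof (induction n arbitrary: m)
  case 0
  show ?case by (simp add: box_poly_zero_right)
next
  case (Suc n)
  note IH_n = Suc.IH
  show ?case
  \<comment> \<open>The inner induction keeps \<open>n\<close> fixed; the outer hypothesis holds for
    all \<open>m\<close> and is applied at \<open>Suc m\<close>.\<close>
  proof (induction m)
    case 0
    show ?case
      by (simp only: add_0 fwd_diff_funpow_monom_self box_poly_0) (simp add: one_pCons del: fact_Suc)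
  next
    case (Suc m)
    have coeff: "1 / fact (Suc n) * of_nat (Suc n) = (1 / fact n :: 'a)"
      using of_nat_neq_0[of n, where 'a = 'a] by (simp del: of_nat_Suc)
    \<comment> \<open>The exponents \<open>m + Suc n\<close> and \<open>Suc m + n\<close> agree, so
      one monomial serves both induction hypotheses; \<open>coeff\<close> turns the Leibniz
      coefficient into the normalisation needed at \<open>n\<close>.\<close>
    have "smult (1 / fact (Suc n)) ((fwd_diff ^^ Suc n) (monom (1::'a) (Suc m + Suc n))) =
        [:of_nat (Suc n), 1:] *
          smult (1 / fact (Suc n)) ((fwd_diff ^^ Suc n) (monom 1 (m + Suc n)))
        + smult (1 / fact n) ((fwd_diff ^^ n) (monom 1 (Suc m + n)))"
      unfolding add_Suc add_Suc_right fwd_diff_funpow_Suc_monom_Suc[of n "Suc (m + n)"]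
        smult_add_right smult_smult coeff mult_smult_right ..
    also have "\<dots> = box_poly (Suc m) (Suc n)"
      unfolding Suc.IH[symmetric] IH_n[symmetric] box_poly_Suc_Suc ..
    finally show ?case ..
  qed
qed

end
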